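(* Let $0 < \varepsilon \le \frac{1}{10}$ and $0 < \beta \le \frac{\varepsilon}{9}$. The algorithm $\mathcal{ALG}^\varepsilon_{PS}$, with first output $\mathcal{ALG}_1(S) = W'_S$ and second output $\mathcal{ALG}_2(S) = w(\hat{M}(S))$, is an $\bigl(\mathsf{MWM}, 2+2\varepsilon, 3+20\varepsilon, \beta\bigr)$-refined lookahead algorithm. That is, for every stream $S$ of weighted edges, $W'_S \le \mathsf{MWM}(S) \le (2+2\varepsilon) W'_S$, and for every partition $S = ABC$ into consecutive substreams with $W'_B \ge (1-\beta) W'_{AB}$, we have $w(\hat{M}(BC)) \le \mathsf{MWM}(ABC) \le (3+20\varepsilon)\cdot w(\hat{M}(BC))$.
   Context: A stream is a sequence of edges on a vertex set $V$, each edge $e$ with weight $w(e)>0$; $AB$, $ABC$ denote concatenations of streams; $w(F)=\sum_{e\in F} w(e)$ and $\mathsf{MWM}(S)$ is the maximum weight of a matching in the graph formed by the edges of $S$. Algorithm $\mathcal{ALG}^\varepsilon_{PS}$ on a stream $S$: initialize an empty stack and potentials $\varphi(v) = 0$ for all $v\in V$. When edge $e=\{u,v\}$ arrives: if $w(e) < (1+\varepsilon)(\varphi(u)+\varphi(v))$, set $w'(e)=0$; otherwise set $w'(e) = w(e) - (\varphi(u)+\varphi(v))$, increase both $\varphi(u)$ and $\varphi(v)$ by $w'(e)$, and push $e$ on the stack. Then, for each $x\in\{u,v\}$, if $x$ is incident to more than $\frac{3\log(1/\varepsilon)}{\varepsilon}+1$ edges in the stack, remove the oldest stack edge incident to $x$.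 After the stream ends, pop the stack edges one by one, adding each popped edge to an initially empty matching $\hat{M}$ whenever $\hat{M}$ stays a matching; $\hat{M}(S)$ is the result. $w'_S(e)$ denotes the value $w'(e)$ (reduced weight) computed in the run on $S$, and $W'_S = \sum_{e\in S} w'_S(e)$. An $(f,\alpha_1,\alpha_2,\beta)$-refined lookahead algorithm is a streaming algorithm with two outputs $\mathcal{ALG}_1,\mathcal{ALG}_2$ such that for every stream $S$: (1) $\mathcal{ALG}_1(S)\le f(S)\le \alpha_1 \mathcal{ALG}_1(S)$, and (2) for every partition $S=ABC$ with $\mathcal{ALG}_1(B)\ge(1-\beta)\mathcal{ALG}_1(AB)$, $\mathcal{ALG}_2(BC)\le f(ABC)\le\alpha_2\mathcal{ALG}_2(BC)$. *)

theory Defs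
  imports Complex_Main
begin

text \<open>A stream item \<open>(u, v, w)\<close> is the edge \<open>{u, v}\<close> with weight \<open>w\<close>. The order in which the
  endpoints are listed only fixes the order in which the algorithm visits them when it trims the
  stack. Repeated and parallel edges are allowed.\<close>

type_synonym 'v wedge = "'v \<times> 'v \<times> real"

fun ends :: "'v wedge \<Rightarrow> 'v set" where
  "ends (u, v, w) = {u, v}"

fun wt :: "'v wedge \<Rightarrow> real" where
  "wt (u, v, w) = w"

definition is_stream :: "'v wedge list \<Rightarrow> bool" where
  "is_stream S \<longleftrightarrow> (\<forall>(u, v, w) \<in> set S. u \<noteq> v \<and> w > 0)"

definition is_matching :: "'v wedge set \<Rightarrow> bool" where
  "is_matching M \<longleftrightarrow> (\<forall>e\<in>M. \<forall>e'\<in>M. e \<noteq> e' \<longrightarrow> ends e \<inter> ends e' = {})"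

definition weight :: "'v wedge set \<Rightarrow> real" where
  "weight F = (\<Sum>e\<in>F. wt e)"

definition MWM :: "'v wedge list \<Rightarrow> real" where
  "MWM S = Max (weight ` {M. M \<subseteq> set S \<and> is_matching M})"

text \<open>The stack is listed from the oldest edge to the most recent one; \<open>rweights\<close> records the
  reduced weights of all edges seen so far, in order of arrival.\<close>

record 'v ps_state =
  pot :: "'v \<Rightarrow> real"
  stack :: "'v wedge list"
  rweights :: "real list"

definition ps_init :: "'v ps_state" where
  "ps_init = \<lparr>pot = (\<lambda>_. 0), stack = [], rweights = []\<rparr>"

definition remove_oldest :: "'v \<Rightarrow> 'v wedge list \<Rightarrow> 'v wedge list" where
  "remove_oldest x st =
     takeWhile (\<lambda>e. x \<notin> ends e) st @ tl (dropWhile (\<lambda>e. x \<notin> ends e) st)"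

definition trim :: "real \<Rightarrow> 'v \<Rightarrow> 'v wedge list \<Rightarrow> 'v wedge list" where
  "trim \<epsilon> x st =
     (if real (length (filter (\<lambda>e. x \<in> ends e) st)) > 3 * ln (1 / \<epsilon>) / \<epsilon> + 1
      then remove_oldest x st else st)"

fun ps_step :: "real \<Rightarrow> 'v ps_state \<Rightarrow> 'v wedge \<Rightarrow> 'v ps_state" where
  "ps_step \<epsilon> \<sigma> (u, v, w) =
     (let \<phi> = pot \<sigma>;
          push = (\<not> w < (1 + \<epsilon>) * (\<phi> u + \<phi> v));
          w' = (if push then w - (\<phi> u + \<phi> v) else 0);
          \<phi>' = (if push then \<phi>(u := \<phi> u + w', v := \<phi> v + w') else \<phi>);
          st = (if push then stack \<sigma> @ [(u, v, w)] else stack \<sigma>)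
      in \<lparr>pot = \<phi>', stack = trim \<epsilon> v (trim \<epsilon> u st), rweights = rweights \<sigma> @ [w']\<rparr>)"

definition ps_run :: "real \<Rightarrow> 'v wedge list \<Rightarrow> 'v ps_state" where
  "ps_run \<epsilon> S = foldl (ps_step \<epsilon>) ps_init S"

definition reduced_total :: "real \<Rightarrow> 'v wedge list \<Rightarrow> real" where
  "reduced_total \<epsilon> S = sum_list (rweights (ps_run \<epsilon> S))"

text \<open>\<open>foldr\<close> processes the stack from its last, i.e. most recent, element.\<close>

definition ps_matching :: "real \<Rightarrow> 'v wedge list \<Rightarrow> 'v wedge set" where
  "ps_matching \<epsilon> S =
     foldr (\<lambda>e M. if is_matching (insert e M) then insert e M else M) (stack (ps_run \<epsilon> S)) {}"

text \<open>The algorithm is given by its two outputs; \<open>valid\<close> singles out the admissible streams.\<close>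

definition refined_lookahead ::
  "('a list \<Rightarrow> bool) \<Rightarrow> ('a list \<Rightarrow> real) \<Rightarrow> real \<Rightarrow> real \<Rightarrow> real
    \<Rightarrow> ('a list \<Rightarrow> real) \<Rightarrow> ('a list \<Rightarrow> real) \<Rightarrow> bool" where
  "refined_lookahead valid f \<alpha>1 \<alpha>2 \<beta> ALG1 ALG2 \<longleftrightarrow>
     (\<forall>S. valid S \<longrightarrow>
        ALG1 S \<le> f S \<and> f S \<le> \<alpha>1 * ALG1 S \<and>
        (\<forall>A B C. S = A @ B @ C \<and> ALG1 B \<ge> (1 - \<beta>) * ALG1 (A @ B) \<longrightarrow>
           ALG2 (B @ C) \<le> f (A @ B @ C) \<and> f (A @ B @ C) \<le> \<alpha>2 * ALG2 (B @ C)))"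

end

theory Submission
  imports Defs "HOL-Library.Sublist"
begin

text \<open>Write \<open>\<phi>\<^sub>S\<close> for the final potentials on \<open>S\<close>, so that \<open>\<Sum>\<phi>\<^sub>S = 2 W'\<^sub>S\<close>. Every edge \<open>{u, v}\<close> of \<open>S\<close>
  weighs at most \<open>(1 + \<epsilon>) (\<phi>\<^sub>S u + \<phi>\<^sub>S v)\<close>. Conversely, a pushed edge weighs as much as its own reduced
  weight plus, for each endpoint, the reduced weights of the earlier pushed edges there. Hence
  unwinding any subsequence of the pushed edges greedily from the end yields a matching at least as
  heavy as the sum of the reduced weights in it. Potentials grow by a factor \<open>1 + \<epsilon>\<close> at each push,
  so trimmed edges are negligible and \<open>w(M) \<ge> (1 - 2 \<epsilon>) W'\<^sub>S\<close> for the output matching \<open>M\<close>.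

  For the lookahead bound split an optimal matching of \<open>ABC\<close> into its edges outside \<open>BC\<close>, covering
  the vertices \<open>X\<close>, and its edges in \<open>BC\<close>, covering \<open>Y\<close>. Its weight is at most
  \<open>(1 + \<epsilon>) (\<phi>\<^bsub>AB\<^esub>(X) + \<phi>\<^bsub>BC\<^esub>(Y))\<close>. Unwinding only the pushed edges of \<open>B\<close> that avoid \<open>X\<close> gives a matching of
  weight at least \<open>W'\<^sub>B - \<phi>\<^sub>B(X)\<close>, which forces \<open>(1 + \<epsilon>) \<phi>\<^bsub>AB\<^esub>(V - X) \<ge> W'\<^sub>B - \<phi>\<^sub>B(X)\<close>. Since
  \<open>\<phi>\<^sub>B \<le> \<phi>\<^bsub>BC\<^esub>\<close> and \<open>W'\<^bsub>AB\<^esub> \<approx> W'\<^sub>B \<le> W'\<^bsub>BC\<^esub>\<close>, the total is about \<open>2 W'\<^bsub>AB\<^esub> - W'\<^sub>B + 2 W'\<^bsub>BC\<^esub> \<le> 3 W'\<^bsub>BC\<^esub>\<close>.\<close>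

text \<open>Total rise of the potential at \<open>x\<close> caused by the pushes in
  \<open>T\<close>, each of which raises both ends of its edge by \<open>r\<close>.\<close>

definition load :: "('v wedge \<times> real) list \<Rightarrow> 'v \<Rightarrow> real" where
  "load T x = (\<Sum>(e, r)\<leftarrow>T. if x \<in> ends e then r else 0)"

definition log_total :: "('v wedge \<times> real) list \<Rightarrow> real" where
  "log_total T = sum_list (map snd T)"

abbreviation degree :: "'v \<Rightarrow> 'v wedge list \<Rightarrow> nat" where
  "degree x st \<equiv> length (filter (\<lambda>e. x \<in> ends e) st)"

text \<open>The pairs \<open>(e, r)\<close> are pushed edges with their reduced weights, and \<open>l\<close> is the potential before
  the first of them. Only inequalities are imposed, which makes the notion stable under passing to
  subsequences: that only lowers the potentials.\<close>

fun charged :: "real \<Rightarrow> ('v \<Rightarrow> real) \<Rightarrow> ('v wedge \<times> real) list \<Rightarrow> bool" where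
  "charged \<epsilon> l [] = True"
| "charged \<epsilon> l ((e, r) # T) \<longleftrightarrow>
     0 \<le> r \<and> \<epsilon> * (\<Sum>x\<in>ends e. l x) \<le> r \<and> r + (\<Sum>x\<in>ends e. l x) \<le> wt e \<and>
     charged \<epsilon> (\<lambda>x. l x + (if x \<in> ends e then r else 0)) T"

text \<open>The unwinding phase of \<open>ps_matching\<close> on an arbitrary list: it is also
  applied to lists of pushed edges that need not be the stack of a run.\<close>

abbreviation greedy :: "'v wedge list \<Rightarrow> 'v wedge set" where
  "greedy st \<equiv> foldr (\<lambda>e M. if is_matching (insert e M) then insert e M else M) st {}"

lemma load_simps [simp]:
  "load [] x = 0"
  "load ((e, r) # T) x = (if x \<in> ends e then r else 0) + load T x"
  "load (T @ T') x = load T x + load T' x"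
  by (simp_all add: load_def)

lemma total_simps [simp]:
  "log_total [] = 0" "log_total (p # T) = snd p + log_total T" "log_total (T @ T') = log_total T + log_total T'"
  by (simp_all add: log_total_def)

lemma finite_ends [simp]: "finite (ends e)"
  by (cases e) auto

lemma ends_nonempty: "ends e \<noteq> {}"
  by (cases e) auto

subsection \<open>Charged lists\<close>

lemma charged_antimono:
  assumes "charged \<epsilon> l T" "\<And>x. l' x \<le> l x" "0 \<le> \<epsilon>"
  shows "charged \<epsilon> l' T"
  using assms
proof (induction T arbitrary: l l')
  case (Cons p T)
  obtain e r where p: "p = (e, r)" by (cases p)
  have le: "(\<Sum>x\<in>ends e. l' x) \<le> (\<Sum>x\<in>ends e. l x)"
    using Cons.prems by (intro sum_mono) auto
  have "\<epsilon> * (\<Sum>x\<in>ends e. l' x) \<le> \<epsilon> * (\<Sum>x\<in>ends e. l x)"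
    using le Cons.prems by (intro mult_left_mono) auto
  moreover have "charged \<epsilon> (\<lambda>x. l' x + (if x \<in> ends e then r else 0)) T"
    by (rule Cons.IH[where l = "\<lambda>x. l x + (if x \<in> ends e then r else 0)"])
      (use Cons.prems p in auto)
  ultimately show ?case using Cons.prems le p by auto
qed simp

text \<open>Dropping a pair with \<open>0 \<le> r\<close> lowers the potentials met by all later
  pairs, and \<open>charged_antimono\<close> tolerates that.\<close>

lemma charged_subseq:
  assumes "subseq T' T" "charged \<epsilon> l T" "0 \<le> \<epsilon>"
  shows "charged \<epsilon> l T'"
  using assms
proof (induction arbitrary: l rule: list_emb.induct)
  case (list_emb_Cons xs ys y)
  obtain e r where p: "y = (e, r)" by (cases y)
  have "charged \<epsilon> (\<lambda>x. l x + (if x \<in> ends e then r else 0)) xs"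
    using list_emb_Cons p by auto
  then show ?case
    by (rule charged_antimono) (use list_emb_Cons.prems p in auto)
next
  case (list_emb_Cons2 x y xs ys)
  then show ?case by (cases x) auto
qed simp

text \<open>The definition peels off the oldest pair, which suits greedy unwinding; a run appends at
  the other end, hence this second form.\<close>

lemma charged_snoc:
  "charged \<epsilon> l (T @ [(e, r)]) \<longleftrightarrow> charged \<epsilon> l T \<and> 0 \<le> r \<and>
     \<epsilon> * (\<Sum>x\<in>ends e. l x + load T x) \<le> r \<and> r + (\<Sum>x\<in>ends e. l x + load T x) \<le> wt e"
  by (induction T arbitrary: l) (auto simp: add.assoc)

lemma charged_log_total_nonneg: "charged \<epsilon> l T \<Longrightarrow> 0 \<le> log_total T"
  by (induction T arbitrary: l) auto

lemma charged_load_nonneg: "charged \<epsilon> l T \<Longrightarrow> 0 \<le> load T x"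
  by (induction T arbitrary: l) auto

text \<open>Each edge at \<open>x\<close> has \<open>r\<close> at least \<epsilon> times the current
  potential at \<open>x\<close>, so it multiplies that potential by at least 1 + \<epsilon>.\<close>

lemma charged_load_growth:
  assumes "charged \<epsilon> l T" "\<And>y. 0 \<le> l y" "0 \<le> \<epsilon>"
  shows "(1 + \<epsilon>) ^ degree x (map fst T) * l x \<le> l x + load T x"
  using assms
proof (induction T arbitrary: l)
  case (Cons p T)
  obtain e r where p: "p = (e, r)" by (cases p)
  let ?l = "\<lambda>x. l x + (if x \<in> ends e then r else 0)"
  have IH: "(1 + \<epsilon>) ^ degree x (map fst T) * ?l x \<le> ?l x + load T x"
    using Cons p by (intro Cons.IH) auto
  show ?case
  proof (cases "x \<in> ends e")
    case True
    have "\<epsilon> * l x \<le> \<epsilon> * (\<Sum>x\<in>ends e. l x)"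
      using Cons.prems True by (intro mult_left_mono member_le_sum) auto
    then have "(1 + \<epsilon>) * l x \<le> ?l x"
      using Cons.prems p True by (simp add: algebra_simps)
    then have "(1 + \<epsilon>) ^ degree x (map fst T) * ((1 + \<epsilon>) * l x)
        \<le> (1 + \<epsilon>) ^ degree x (map fst T) * ?l x"
      using Cons.prems by (intro mult_left_mono) auto
    with IH True p show ?thesis by (simp add: mult_ac)
  qed (use IH p in auto)
qed simp

subsection \<open>Greedy matchings\<close>

lemma greedy_subset: "greedy st \<subseteq> set st"
  by (induction st) auto

lemma finite_greedy: "finite (greedy st)"
  using finite_subset[OF greedy_subset] by blast

text \<open>The case \<open>e \<in> M\<close> is real: streams may repeat an item, while matchings
  are sets.\<close>

lemma is_matching_insert:
  "is_matching (insert e M) \<longleftrightarrow> is_matching M \<and> (e \<in> M \<or> ends e \<inter> \<Union>(ends ` M) = {})"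
proof -
  have "ends e \<inter> \<Union>(ends ` M) = {} \<longleftrightarrow> (\<forall>e'\<in>M. ends e \<inter> ends e' = {})"
    by (simp only: Int_UN_distrib SUP_bot_conv)
  then show ?thesis unfolding is_matching_def by (metis Int_commute insert_iff)
qed

lemma is_matching_greedy: "is_matching (greedy st)"
proof (induction st)
  case Nil
  show ?case by (simp add: is_matching_def)
qed simp

text \<open>Induction from the oldest edge, which unwinding treats last. The sum of \<open>l\<close>
  over covered vertices carries the induction: an added edge weighs at least \<open>r\<close> plus
  \<open>l\<close> at its ends, and for a blocked edge some covered end has had its potential raised
  by \<open>r\<close>, so the later edges already pay for it.\<close>

lemma charged_greedy_weight:
  assumes "charged \<epsilon> l T" "\<And>x. 0 \<le> l x"
  shows "log_total T + (\<Sum>x\<in>\<Union>(ends ` greedy (map fst T)). l x) \<le> weight (greedy (map fst T))"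
  using assms
proof (induction T arbitrary: l)
  case Nil
  then show ?case by (simp add: weight_def)
next
  case (Cons p T)
  obtain e r where p: "p = (e, r)" by (cases p)
  let ?l = "\<lambda>x. l x + (if x \<in> ends e then r else 0)"
  let ?M = "greedy (map fst T)"
  let ?V = "\<Union>(ends ` ?M)"
  have fin: "finite ?M" "finite ?V"
    using finite_greedy[of "map fst T"] by (simp_all del: ends.simps)
  have r: "0 \<le> r" using Cons.prems p by simp
  have IH: "log_total T + (\<Sum>x\<in>?V. ?l x) \<le> weight ?M"
    using Cons p by (intro Cons.IH) auto
  have split: "(\<Sum>x\<in>?V. ?l x) = (\<Sum>x\<in>?V. l x) + (\<Sum>x\<in>?V. if x \<in> ends e then r else 0)"
    by (simp add: sum.distrib)
  show ?case
  proof (cases "ends e \<inter> ?V = {}")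
    case True
    have "e \<notin> ?M" using True ends_nonempty[of e] by blast
    moreover have "is_matching (insert e ?M)"
      using True is_matching_greedy[of "map fst T"] by (simp add: is_matching_insert)
    moreover have "(\<Sum>x\<in>ends e \<union> ?V. l x) = (\<Sum>x\<in>ends e. l x) + (\<Sum>x\<in>?V. l x)"
      using True fin by (intro sum.union_disjoint) auto
    moreover have "0 \<le> (\<Sum>x\<in>?V. if x \<in> ends e then r else 0)"
      using r by (intro sum_nonneg) auto
    ultimately show ?thesis
      using IH split Cons.prems p fin by (simp add: weight_def)
  next
    case False
    then obtain x where x: "x \<in> ends e" "x \<in> ?V" by blast
    have "r \<le> (\<Sum>x\<in>?V. if x \<in> ends e then r else 0)"
      using member_le_sum[of x ?V "\<lambda>x. if x \<in> ends e then r else 0"] x fin r by auto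
    \<comment> \<open>A blocked edge may still pass the matching test if an identical item was
      already taken; inserting it then changes nothing.\<close>
    moreover have "greedy (map fst (p # T)) = ?M"
    proof (cases "is_matching (insert e ?M)")
      case True
      with x have "e \<in> ?M" unfolding is_matching_insert by blast
      then show ?thesis using p by (simp add: insert_absorb)
    qed (use p in simp)
    ultimately show ?thesis using IH split p by simp
  qed
qed

subsection \<open>Trimming\<close>

lemma remove_oldest_append:
  "\<forall>e\<in>set st. x \<notin> ends e \<Longrightarrow> x \<in> ends e \<Longrightarrow> remove_oldest x (st @ e # st') = st @ st'"
  by (induction st) (simp_all add: remove_oldest_def)

lemma degree_remove_oldest:
  "x \<in> \<Union>(ends ` set st) \<Longrightarrow> Suc (degree x (remove_oldest x st)) = degree x st"
  by (induction st) (auto simp: remove_oldest_def)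

lemma degree_remove_oldest_le: "degree y (remove_oldest x st) \<le> degree y st"
  by (induction st) (auto simp: remove_oldest_def)

lemma degree_trim_le: "degree y (trim \<epsilon> x st) \<le> degree y st"
  by (simp add: trim_def degree_remove_oldest_le)

text \<open>After taking logarithms, \<open>n * ln (1 + \<epsilon>)\<close> must reach
  \<open>2 * ln (1 / \<epsilon>)\<close>. The factor 3 in the threshold leaves room for
  \<open>ln (1 + \<epsilon>) \<ge> 9 / 10 * \<epsilon>\<close> and for \<open>Suc n\<close> in place
  of \<open>n\<close>.\<close>

lemma trim_threshold_growth:
  fixes \<epsilon> :: real
  assumes "0 < \<epsilon>" "\<epsilon> \<le> 1 / 10" "3 * ln (1 / \<epsilon>) / \<epsilon> < real (Suc n)"
  shows "1 \<le> \<epsilon>\<^sup>2 * (1 + \<epsilon>) ^ n"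
proof -
  have l: "ln (1 / \<epsilon>) \<ge> 9 / 10"
    using ln_le_minus_one[of \<epsilon>] assms by (simp add: ln_div)
  have l1: "ln (1 + \<epsilon>) \<ge> \<epsilon> - \<epsilon>\<^sup>2" using ln_one_plus_pos_lower_bound[of \<epsilon>] assms by simp
  have "\<epsilon> - \<epsilon>\<^sup>2 \<ge> 9 / 10 * \<epsilon>" using assms by (simp add: power2_eq_square)
  with l1 have l2: "ln (1 + \<epsilon>) \<ge> 9 / 10 * \<epsilon>" by linarith
  have "3 * ln (1 / \<epsilon>) < \<epsilon> * (real n + 1)"
    using assms by (simp add: field_simps)
  then have "2 * ln (1 / \<epsilon>) \<le> real n * (9 / 10 * \<epsilon>)"
    using l assms by (simp add: algebra_simps)
  also have "\<dots> \<le> real n * ln (1 + \<epsilon>)"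
    using l2 by (intro mult_left_mono) auto
  finally have "0 \<le> ln (\<epsilon>\<^sup>2 * (1 + \<epsilon>) ^ n)"
    using assms by (simp add: ln_mult ln_realpow ln_div)
  then show ?thesis using assms by (simp add: ln_ge_zero_iff)
qed

text \<open>If an edge of reduced weight \<open>r0\<close> is removed, enough younger edges at
  \<open>x\<close> have been pushed to raise the potential there to at least
  \<open>r0 / \<epsilon>\<^sup>2\<close>. The new edge has \<open>r\<close> at least \<epsilon>
  times that potential, so \<open>r0 \<le> \<epsilon> * r\<close>.\<close>

lemma trim_charged:
  assumes \<epsilon>: "0 < \<epsilon>" "\<epsilon> \<le> 1 / 10"
    and ch: "charged \<epsilon> (\<lambda>_. 0) (T @ [(e, r)])" and x: "x \<in> ends e"
  shows "\<exists>T'. subseq T' T \<and> map fst (T' @ [(e, r)]) = trim \<epsilon> x (map fst T @ [e]) \<and>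
           log_total T - \<epsilon> * r \<le> log_total T'"
proof (cases "real (degree x (map fst T @ [e])) > 3 * ln (1 / \<epsilon>) / \<epsilon> + 1")
  case False
  then show ?thesis using ch \<epsilon>
    by (intro exI[of _ T]) (auto simp: trim_def charged_snoc)
next
  case True
  \<comment> \<open>The threshold is at least 1, so some edge of \<open>T\<close> meets
    \<open>x\<close>, and the oldest such edge is not the new edge \<open>e\<close>.\<close>
  have "ln (1 / \<epsilon>) \<ge> 0" using \<epsilon> by simp
  then have "0 \<le> 3 * ln (1 / \<epsilon>) / \<epsilon>" using \<epsilon> by simp
  with True x have "degree x (map fst T) > 0" by (cases "degree x (map fst T)") auto
  then have "\<exists>p\<in>set T. x \<in> ends (fst p)" by (auto simp: filter_empty_conv)
  from split_list_first_prop[OF this]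
  obtain T1 f T2 where T: "T = T1 @ f # T2" "x \<in> ends (fst f)"
      "\<forall>p\<in>set T1. x \<notin> ends (fst p)"
    by blast
  obtain e0 r0 where f: "f = (e0, r0)" by (cases f)
  have empty: "filter (\<lambda>e. x \<in> ends e) (map fst T1) = []"
    using T by (auto simp: filter_empty_conv)
  have cT: "charged \<epsilon> (\<lambda>_. 0) T" and r: "\<epsilon> * (\<Sum>x\<in>ends e. load T x) \<le> r"
    using ch by (auto simp: charged_snoc)
  \<comment> \<open>Starting from zero at \<open>f\<close> forgets \<open>T1\<close>. After
    \<open>f\<close> the potential at \<open>x\<close> is \<open>r0\<close>, and the edges of
    \<open>T2\<close> make it grow.\<close>
  have "charged \<epsilon> (\<lambda>_. 0) (f # T2)"
    by (rule charged_subseq[OF _ cT]) (use T \<epsilon> in auto)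
  then have c2: "charged \<epsilon> (\<lambda>x. if x \<in> ends e0 then r0 else 0) T2" and r0: "0 \<le> r0"
    using f by auto
  let ?n = "degree x (map fst T2)"
  have growth: "(1 + \<epsilon>) ^ ?n * r0 \<le> r0 + load T2 x"
    using charged_load_growth[OF c2, of x] r0 \<epsilon> T f by auto
  have "charged \<epsilon> (\<lambda>_. 0) T1" by (rule charged_subseq[OF _ cT]) (use T \<epsilon> in auto)
  then have "r0 + load T2 x \<le> load T x"
    using T f charged_load_nonneg[of \<epsilon> _ T1 x] by auto
  also have "\<dots> \<le> (\<Sum>x\<in>ends e. load T x)"
    using x charged_load_nonneg[OF cT] by (intro member_le_sum) auto
  finally have "(1 + \<epsilon>) ^ ?n * r0 \<le> (\<Sum>x\<in>ends e. load T x)" using growth by linarith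
  then have "\<epsilon> * ((1 + \<epsilon>) ^ ?n * r0) \<le> r"
    using r \<epsilon> by (meson mult_left_mono order.trans less_imp_le)
  then have "\<epsilon> * (\<epsilon> * ((1 + \<epsilon>) ^ ?n * r0)) \<le> \<epsilon> * r"
    using \<epsilon> by (intro mult_left_mono) auto
  then have 1: "\<epsilon>\<^sup>2 * (1 + \<epsilon>) ^ ?n * r0 \<le> \<epsilon> * r" by (simp add: power2_eq_square mult_ac)
  \<comment> \<open>Both \<open>e0\<close> and \<open>e\<close> count towards the degree, which is
    therefore \<open>?n + 2\<close>; one of the two cancels the \<open>+ 1\<close> of the
    threshold.\<close>
  have "3 * ln (1 / \<epsilon>) / \<epsilon> < real (Suc ?n)"
    using True T f x empty by simp
  from trim_threshold_growth[OF \<epsilon> this] have "1 * r0 \<le> \<epsilon>\<^sup>2 * (1 + \<epsilon>) ^ ?n * r0"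
    using r0 by (intro mult_right_mono) auto
  with 1 have small: "r0 \<le> \<epsilon> * r" by linarith
  have "remove_oldest x (map fst T1 @ e0 # (map fst T2 @ [e])) = map fst T1 @ map fst T2 @ [e]"
    using T f by (intro remove_oldest_append) auto
  moreover have "subseq (T1 @ T2) T"
    unfolding T(1) by (intro list_emb_append_mono list_emb_Cons subseq_order.refl)
  ultimately show ?thesis using small T f True
    by (intro exI[of _ "T1 @ T2"]) (auto simp: trim_def)
qed

subsection \<open>The run of the algorithm\<close>

text \<open>Positivity identifies the pushes: on valid streams with \<epsilon> positive a pushed
  edge has positive reduced weight, a rejected one has 0.\<close>

definition push_log :: "real \<Rightarrow> 'v wedge list \<Rightarrow> ('v wedge \<times> real) list" where
  "push_log \<epsilon> S = filter (\<lambda>(e, r). r > 0) (zip S (rweights (ps_run \<epsilon> S)))"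

abbreviation potential :: "real \<Rightarrow> 'v wedge list \<Rightarrow> 'v \<Rightarrow> real" where
  "potential \<epsilon> S \<equiv> pot (ps_run \<epsilon> S)"

lemma ps_run_snoc: "ps_run \<epsilon> (S @ [e]) = ps_step \<epsilon> (ps_run \<epsilon> S) e"
  by (simp add: ps_run_def)

lemma ps_run_Nil: "ps_run \<epsilon> [] = ps_init"
  by (simp add: ps_run_def)

lemma is_stream_append [simp]: "is_stream (S @ S') \<longleftrightarrow> is_stream S \<and> is_stream S'"
  by (simp add: is_stream_def ball_Un)

lemma is_stream_Cons [simp]:
  "is_stream ((u, v, w) # S) \<longleftrightarrow> u \<noteq> v \<and> 0 < w \<and> is_stream S"
  by (auto simp: is_stream_def)

lemma length_rweights: "length (rweights (ps_run \<epsilon> S)) = length S"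
proof (induction S rule: rev_induct)
  case (snoc e S)
  then show ?case by (cases e) (simp add: ps_run_snoc Let_def)
qed (simp add: ps_run_Nil ps_init_def)

text \<open>The first bound is the push test rearranged. It gives positivity unless
  \<open>s = 0\<close>, where the positive edge weight is used instead.\<close>

lemma reduced_weight_ge:
  fixes \<epsilon> w s :: real
  assumes "0 < \<epsilon>" "0 < w" "0 \<le> s" "\<not> w < (1 + \<epsilon>) * s"
  shows "\<epsilon> * s \<le> w - s" "0 < w - s"
proof -
  show 1: "\<epsilon> * s \<le> w - s" using assms by (simp add: algebra_simps)
  show "0 < w - s"
  proof (cases "s = 0")
    case False
    then have "0 < \<epsilon> * s" using assms by simp
    with 1 show ?thesis by linarith
  qed (use assms in simp)
qed

lemma potential_nonneg:
  assumes "0 < \<epsilon>" "is_stream S"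
  shows "0 \<le> potential \<epsilon> S x"
  using assms(2)
proof (induction S arbitrary: x rule: rev_induct)
  case (snoc e S)
  obtain u v w where e: "e = (u, v, w)" by (cases e)
  have "0 \<le> potential \<epsilon> S u" "0 \<le> potential \<epsilon> S v" "0 \<le> potential \<epsilon> S x" "0 < w"
    using snoc e by auto
  then show ?case
    using e reduced_weight_ge(2)[of \<epsilon> w "potential \<epsilon> S u + potential \<epsilon> S v"] assms(1)
    by (auto simp: ps_run_snoc Let_def)
qed (simp add: ps_run_Nil ps_init_def)

lemma push_log_snoc:
  assumes "0 < \<epsilon>" "is_stream (S @ [(u, v, w)])"
  defines "s \<equiv> potential \<epsilon> S u + potential \<epsilon> S v"
  shows "push_log \<epsilon> (S @ [(u, v, w)]) =
           push_log \<epsilon> S @ (if w < (1 + \<epsilon>) * s then [] else [((u, v, w), w - s)])"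
  using reduced_weight_ge(2)[of \<epsilon> w s] assms potential_nonneg[of \<epsilon> S]
  by (auto simp: push_log_def ps_run_snoc Let_def length_rweights)

lemma set_push_log: "fst ` set (push_log \<epsilon> S) \<subseteq> set S"
  by (auto simp: push_log_def dest: set_zip_leftD)

lemma potential_eq_load:
  assumes "0 < \<epsilon>" "is_stream S"
  shows "potential \<epsilon> S = load (push_log \<epsilon> S)"
  using assms(2)
proof (induction S rule: rev_induct)
  case Nil
  then show ?case by (auto simp: ps_run_Nil ps_init_def push_log_def)
next
  case (snoc e S)
  obtain u v w where e: "e = (u, v, w)" by (cases e)
  have "push_log \<epsilon> (S @ [e]) = push_log \<epsilon> S @ (if w < (1 + \<epsilon>) * (potential \<epsilon> S u + potential \<epsilon> S v)
     then [] else [((u, v, w), w - (potential \<epsilon> S u + potential \<epsilon> S v))])"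
    using push_log_snoc[of \<epsilon> S u v w] assms(1) snoc.prems e by simp
  with snoc e show ?case
    by (auto simp: fun_eq_iff ps_run_snoc Let_def)
qed

lemma reduced_total_eq:
  assumes "0 < \<epsilon>" "is_stream S"
  shows "reduced_total \<epsilon> S = log_total (push_log \<epsilon> S)"
  using assms(2)
proof (induction S rule: rev_induct)
  case Nil
  then show ?case by (auto simp: ps_run_Nil ps_init_def push_log_def reduced_total_def)
next
  case (snoc e S)
  obtain u v w where e: "e = (u, v, w)" by (cases e)
  show ?case
    using push_log_snoc[of \<epsilon> S u v w] assms(1) snoc e
    by (auto simp: ps_run_snoc Let_def reduced_total_def)
qed

lemma charged_push_log:
  assumes "0 < \<epsilon>" "is_stream S"
  shows "charged \<epsilon> (\<lambda>_. 0) (push_log \<epsilon> S)"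
  using assms(2)
proof (induction S rule: rev_induct)
  case Nil
  then show ?case by (simp add: push_log_def)
next
  case (snoc e S)
  obtain u v w where e: "e = (u, v, w)" by (cases e)
  then show ?case
    using push_log_snoc[of \<epsilon> S u v w] assms(1) snoc potential_nonneg[of \<epsilon> S]
      reduced_weight_ge[of \<epsilon> w "potential \<epsilon> S u + potential \<epsilon> S v"]
    by (auto simp: charged_snoc simp flip: potential_eq_load)
qed

lemma push_log_append:
  assumes "0 < \<epsilon>" "is_stream (S @ S')"
  shows "\<exists>T. push_log \<epsilon> (S @ S') = push_log \<epsilon> S @ T \<and> (\<forall>p\<in>set T. 0 \<le> snd p)"
  using assms(2)
proof (induction S' rule: rev_induct)
  case (snoc e S')
  obtain u v w where e: "e = (u, v, w)" by (cases e)
  then show ?case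
    using push_log_snoc[of \<epsilon> "S @ S'" u v w] assms(1) snoc potential_nonneg[of \<epsilon> "S @ S'"]
      reduced_weight_ge[of \<epsilon> w "potential \<epsilon> (S @ S') u + potential \<epsilon> (S @ S') v"]
    by fastforce
qed simp

lemma potential_mono:
  assumes "0 < \<epsilon>" "is_stream (S @ S')"
  shows "potential \<epsilon> S x \<le> potential \<epsilon> (S @ S') x"
proof -
  obtain T where T: "push_log \<epsilon> (S @ S') = push_log \<epsilon> S @ T" "\<forall>p\<in>set T. 0 \<le> snd p"
    using push_log_append[OF assms] by blast
  have "0 \<le> load T x" using T(2) by (force simp: load_def intro!: sum_list_nonneg)
  then show ?thesis using assms T(1) by (simp add: potential_eq_load)
qed

lemma reduced_total_mono:
  assumes "0 < \<epsilon>" "is_stream (S @ S')"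
  shows "reduced_total \<epsilon> S \<le> reduced_total \<epsilon> (S @ S')"
proof -
  obtain T where T: "push_log \<epsilon> (S @ S') = push_log \<epsilon> S @ T" "\<forall>p\<in>set T. 0 \<le> snd p"
    using push_log_append[OF assms] by blast
  have "0 \<le> log_total T" using T(2) by (auto simp: log_total_def intro!: sum_list_nonneg)
  then show ?thesis using assms T(1) by (simp add: reduced_total_eq)
qed

lemma reduced_total_nonneg:
  "0 < \<epsilon> \<Longrightarrow> is_stream S \<Longrightarrow> 0 \<le> reduced_total \<epsilon> S"
  using charged_log_total_nonneg[OF charged_push_log] by (simp add: reduced_total_eq)

section \<open>Scaled potentials as a fractional vertex cover\<close>

text \<open>A rejected edge satisfies the bound on arrival by the failed test. A push raises both
  ends by \<open>w - s\<close>, giving \<open>s' = w + (w - s) \<ge> w\<close>. Later potentials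
  only grow.\<close>

lemma wt_le_potential:
  assumes "0 < \<epsilon>" "is_stream S" "e \<in> set S"
  shows "wt e \<le> (1 + \<epsilon>) * (\<Sum>x\<in>ends e. potential \<epsilon> S x)"
proof -
  obtain u v w where e: "e = (u, v, w)" by (cases e)
  obtain S1 S2 where S: "S = (S1 @ [e]) @ S2" using assms(3) by (auto simp: in_set_conv_decomp)
  have str: "is_stream S1" "u \<noteq> v" "0 < w" using S assms(2) e by auto
  define s where "s = potential \<epsilon> S1 u + potential \<epsilon> S1 v"
  define s' where "s' = potential \<epsilon> (S1 @ [e]) u + potential \<epsilon> (S1 @ [e]) v"
  have s: "0 \<le> s" using potential_nonneg[OF assms(1) str(1)] by (simp add: s_def)
  have "w \<le> (1 + \<epsilon>) * s'"
  proof (cases "w < (1 + \<epsilon>) * s")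
    case True
    then have "s' = s" using e by (simp add: s_def s'_def ps_run_snoc Let_def)
    then show ?thesis using True by simp
  next
    case False
    then have "s' = s + 2 * (w - s)"
      using e str by (simp add: s_def s'_def ps_run_snoc Let_def)
    then have ge: "w \<le> s'"
      using reduced_weight_ge(2)[OF assms(1) str(3) s False] by simp
    then have "0 \<le> \<epsilon> * s'" using str assms(1) by simp
    with ge show ?thesis by (simp add: algebra_simps)
  qed
  also have "\<dots> \<le> (1 + \<epsilon>) * (\<Sum>x\<in>ends e. potential \<epsilon> S x)"
  proof (rule mult_left_mono)
    show "s' \<le> (\<Sum>x\<in>ends e. potential \<epsilon> S x)"
      using e str S assms potential_mono[of \<epsilon> "S1 @ [e]" S2] by (simp add: s'_def add_mono)
  qed (use assms in simp)
  finally show ?thesis using e by simp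
qed

lemma matching_weight_le_potential:
  assumes "0 < \<epsilon>" "is_stream S" "M \<subseteq> set S" "is_matching M"
  shows "weight M \<le> (1 + \<epsilon>) * (\<Sum>x\<in>\<Union>(ends ` M). potential \<epsilon> S x)"
proof -
  have "weight M \<le> (\<Sum>e\<in>M. (1 + \<epsilon>) * (\<Sum>x\<in>ends e. potential \<epsilon> S x))"
    unfolding weight_def using assms by (intro sum_mono wt_le_potential) auto
  also have "\<dots> = (1 + \<epsilon>) * (\<Sum>e\<in>M. \<Sum>x\<in>ends e. potential \<epsilon> S x)"
    by (simp add: sum_distrib_left)
  also have "(\<Sum>e\<in>M. \<Sum>x\<in>ends e. potential \<epsilon> S x) = (\<Sum>x\<in>\<Union>(ends ` M). potential \<epsilon> S x)"
    using assms finite_subset[OF assms(3)]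
    by (intro sum.UNION_disjoint[symmetric]) (auto simp: is_matching_def)
  finally show ?thesis .
qed

lemma sum_load:
  assumes "finite V" "\<And>e r. (e, r) \<in> set T \<Longrightarrow> ends e \<subseteq> V \<and> card (ends e) = 2"
  shows "(\<Sum>x\<in>V. load T x) = 2 * log_total T"
  using assms(2)
proof (induction T)
  case (Cons p T)
  obtain e r where p: "p = (e, r)" by (cases p)
  have e: "ends e \<subseteq> V" "card (ends e) = 2" using Cons.prems[of e r] p by auto
  then have "V \<inter> {x. x \<in> ends e} = ends e" by auto
  then have "(\<Sum>x\<in>V. if x \<in> ends e then r else 0) = 2 * r"
    using assms(1) e by (simp add: sum.If_cases)
  moreover have "(\<Sum>x\<in>V. load T x) = 2 * log_total T"
    by (rule Cons.IH, rule Cons.prems, erule list.set_intros(2))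
  ultimately show ?case using p by (simp add: sum.distrib)
qed simp

lemma sum_potential:
  assumes "0 < \<epsilon>" "is_stream S" "finite V" "\<Union>(ends ` set S) \<subseteq> V"
  shows "(\<Sum>x\<in>V. potential \<epsilon> S x) = 2 * reduced_total \<epsilon> S"
  unfolding potential_eq_load[OF assms(1,2)] reduced_total_eq[OF assms(1,2)]
proof (rule sum_load[OF assms(3)])
  fix e r assume "(e, r) \<in> set (push_log \<epsilon> S)"
  then have "e \<in> set S" using set_push_log by force
  then show "ends e \<subseteq> V \<and> card (ends e) = 2"
    using assms by (cases e rule: ends.cases) (force simp: is_stream_def)
qed

section \<open>Stack degrees and the weight lost by trimming\<close>

text \<open>A push raises a degree by at most one, so a single removal restores the bound.\<close>

lemma degree_trim:
  assumes "0 < \<epsilon>" "\<epsilon> \<le> 1" "real (degree x st) \<le> 3 * ln (1 / \<epsilon>) / \<epsilon> + 2"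
  shows "real (degree x (trim \<epsilon> x st)) \<le> 3 * ln (1 / \<epsilon>) / \<epsilon> + 1"
proof (cases "real (degree x st) > 3 * ln (1 / \<epsilon>) / \<epsilon> + 1")
  case True
  have "0 \<le> 3 * ln (1 / \<epsilon>) / \<epsilon>" using assms by simp
  with True have "degree x st > 0" by (cases "degree x st") auto
  then have "x \<in> \<Union>(ends ` set st)" by (auto simp: filter_empty_conv)
  from degree_remove_oldest[OF this] True assms(3) show ?thesis
    by (simp add: trim_def)
qed (simp add: trim_def)

text \<open>\<open>ps_step\<close> calls \<open>trim\<close> after rejected edges too; this
  invariant shows that such calls leave the stack unchanged.\<close>

lemma degree_stack:
  assumes "0 < \<epsilon>" "\<epsilon> \<le> 1"
  shows "real (degree x (stack (ps_run \<epsilon> S))) \<le> 3 * ln (1 / \<epsilon>) / \<epsilon> + 1"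
proof (induction S arbitrary: x rule: rev_induct)
  case Nil
  then show ?case using assms by (simp add: ps_run_Nil ps_init_def)
next
  case (snoc e S)
  obtain u v w where e: "e = (u, v, w)" by (cases e)
  let ?L = "3 * ln (1 / \<epsilon>) / \<epsilon>"
  let ?st = "if \<not> w < (1 + \<epsilon>) * (potential \<epsilon> S u + potential \<epsilon> S v)
    then stack (ps_run \<epsilon> S) @ [e] else stack (ps_run \<epsilon> S)"
  have st: "stack (ps_run \<epsilon> (S @ [e])) = trim \<epsilon> v (trim \<epsilon> u ?st)"
    using e by (simp add: ps_run_snoc Let_def)
  have b: "real (degree y ?st) \<le> ?L + 2" for y using snoc[of y] by auto
  have le: "real (degree x (trim \<epsilon> v (trim \<epsilon> u ?st))) \<le> real (degree x (trim \<epsilon> u ?st))"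
      "real (degree x (trim \<epsilon> u ?st)) \<le> real (degree x ?st)"
    by (simp_all only: of_nat_le_iff degree_trim_le)
  consider "x = u" | "x = v" | "x \<noteq> u" "x \<noteq> v" by blast
  then have "real (degree x (trim \<epsilon> v (trim \<epsilon> u ?st))) \<le> ?L + 1"
  proof cases
    case 1
    then show ?thesis using degree_trim[OF assms b[of x]] le by simp
  next
    case 2
    then show ?thesis
      using degree_trim[OF assms, of x "trim \<epsilon> u ?st"] b[of x] le by simp
  next
    case 3
    then have "degree x ?st = degree x (stack (ps_run \<epsilon> S))" using e by auto
    then show ?thesis using snoc[of x] le by simp
  qed
  then show ?case by (simp only: st)
qed

text \<open>An edge trimmed when \<open>e\<close> is pushed has reduced weight at most \<open>\<epsilon>\<close> times that of \<open>e\<close>, and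
  each push trims at most two edges.\<close>

lemma stack_retains_weight:
  assumes \<epsilon>: "0 < \<epsilon>" "\<epsilon> \<le> 1 / 10" and S: "is_stream S"
  shows "\<exists>T. subseq T (push_log \<epsilon> S) \<and> map fst T = stack (ps_run \<epsilon> S) \<and>
           (1 - 2 * \<epsilon>) * log_total (push_log \<epsilon> S) \<le> log_total T"
  using S
proof (induction S rule: rev_induct)
  case Nil
  then show ?case by (simp add: ps_run_Nil ps_init_def push_log_def)
next
  case (snoc e S)
  obtain u v w where e: "e = (u, v, w)" by (cases e)
  define s where "s = potential \<epsilon> S u + potential \<epsilon> S v"
  obtain T where T: "subseq T (push_log \<epsilon> S)" "map fst T = stack (ps_run \<epsilon> S)"
      "(1 - 2 * \<epsilon>) * log_total (push_log \<epsilon> S) \<le> log_total T"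
    using snoc by auto
  have log: "push_log \<epsilon> (S @ [e]) =
      push_log \<epsilon> S @ (if w < (1 + \<epsilon>) * s then [] else [(e, w - s)])"
    using push_log_snoc[of \<epsilon> S u v w] \<epsilon> snoc.prems e by (simp add: s_def)
  show ?case
  proof (cases "w < (1 + \<epsilon>) * s")
    case True
    have "trim \<epsilon> y (stack (ps_run \<epsilon> S)) = stack (ps_run \<epsilon> S)" for y
      using degree_stack[of \<epsilon> y S] \<epsilon> by (simp add: trim_def)
    then have "stack (ps_run \<epsilon> (S @ [e])) = stack (ps_run \<epsilon> S)"
      using True e by (simp add: ps_run_snoc Let_def s_def)
    then show ?thesis using T log True by auto
  next
    case False
    define r where "r = w - s"
    have log: "push_log \<epsilon> (S @ [e]) = push_log \<epsilon> S @ [(e, r)]" using log False r_def by simp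
    \<comment> \<open>Edges trimmed earlier only lowered the potentials in this count, so the
      surviving stack followed by the new edge is still charged and \<open>trim_charged\<close>
      applies twice.\<close>
    have sub: "charged \<epsilon> (\<lambda>_. 0) (T' @ [(e, r)])" if "subseq T' (push_log \<epsilon> S)" for T'
      by (rule charged_subseq[of _ "push_log \<epsilon> (S @ [e])"])
        (use that log \<epsilon> charged_push_log[OF \<epsilon>(1) snoc.prems] in \<open>auto simp: list_emb_append_mono\<close>)
    obtain T1 where T1: "subseq T1 T" "map fst (T1 @ [(e, r)]) = trim \<epsilon> u (map fst T @ [e])"
        "log_total T - \<epsilon> * r \<le> log_total T1"
      using trim_charged[OF \<epsilon> sub[OF T(1)], of u] e by auto
    have T1': "subseq T1 (push_log \<epsilon> S)" using T1(1) T(1) by (rule subseq_order.trans)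
    obtain T2 where T2: "subseq T2 T1" "map fst (T2 @ [(e, r)]) = trim \<epsilon> v (map fst T1 @ [e])"
        "log_total T1 - \<epsilon> * r \<le> log_total T2"
      using trim_charged[OF \<epsilon> sub[OF T1'], of v] e by auto
    have "subseq T2 (push_log \<epsilon> S)" using T2(1) T1' by (rule subseq_order.trans)
    then have "subseq (T2 @ [(e, r)]) (push_log \<epsilon> (S @ [e]))"
      using log by (simp add: list_emb_append_mono)
    moreover have "map fst (T2 @ [(e, r)]) = stack (ps_run \<epsilon> (S @ [e]))"
      using T2(2) T1(2) T(2) e False by (simp add: ps_run_snoc Let_def s_def)
    moreover have "(1 - 2 * \<epsilon>) * log_total (push_log \<epsilon> (S @ [e])) \<le> log_total (T2 @ [(e, r)])"
      using log T(3) T1(3) T2(3) by (simp add: algebra_simps)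
    ultimately show ?thesis by blast
  qed
qed

lemma ps_matching_weight:
  assumes "0 < \<epsilon>" "\<epsilon> \<le> 1 / 10" "is_stream S"
  shows "(1 - 2 * \<epsilon>) * reduced_total \<epsilon> S \<le> weight (ps_matching \<epsilon> S)"
proof -
  obtain T where T: "subseq T (push_log \<epsilon> S)" "map fst T = stack (ps_run \<epsilon> S)"
      "(1 - 2 * \<epsilon>) * log_total (push_log \<epsilon> S) \<le> log_total T"
    using stack_retains_weight[OF assms] by blast
  have "charged \<epsilon> (\<lambda>_. 0) T"
    using charged_subseq[OF T(1) charged_push_log] assms by simp
  then have "log_total T \<le> weight (greedy (map fst T))"
    using charged_greedy_weight by fastforce
  then show ?thesis using T assms by (simp add: ps_matching_def reduced_total_eq)
qed

lemma ps_matching_subset: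
  assumes "0 < \<epsilon>" "\<epsilon> \<le> 1 / 10" "is_stream S"
  shows "ps_matching \<epsilon> S \<subseteq> set S"
proof -
  obtain T where T: "subseq T (push_log \<epsilon> S)" "map fst T = stack (ps_run \<epsilon> S)"
    using stack_retains_weight[OF assms] by blast
  have sub: "set T \<subseteq> set (push_log \<epsilon> S)"
    by (rule subsetI, erule list_emb_set[OF T(1)]) simp
  have "ps_matching \<epsilon> S \<subseteq> set (map fst T)"
    unfolding ps_matching_def T(2) by (rule greedy_subset)
  also have "\<dots> \<subseteq> fst ` set (push_log \<epsilon> S)"
    using image_mono[OF sub] by simp
  also have "\<dots> \<subseteq> set S" by (rule set_push_log)
  finally show ?thesis .
qed

lemma is_matching_ps_matching: "is_matching (ps_matching \<epsilon> S)"
  by (simp add: ps_matching_def is_matching_greedy)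

subsection \<open>The lookahead bounds\<close>

lemma finite_matchings: "finite {M. M \<subseteq> set S \<and> is_matching M}"
  by (rule finite_subset[of _ "Pow (set S)"]) auto

lemma weight_le_MWM: "M \<subseteq> set S \<Longrightarrow> is_matching M \<Longrightarrow> weight M \<le> MWM S"
  unfolding MWM_def using finite_matchings by (intro Max_ge) auto

lemma MWM_le:
  assumes "\<And>M. M \<subseteq> set S \<Longrightarrow> is_matching M \<Longrightarrow> weight M \<le> c"
  shows "MWM S \<le> c"
proof -
  have "{} \<in> {M. M \<subseteq> set S \<and> is_matching M}" by (simp add: is_matching_def)
  then have "weight ` {M. M \<subseteq> set S \<and> is_matching M} \<noteq> {}" by blast
  then show ?thesis
    unfolding MWM_def using finite_matchings assms by (subst Max_le_iff) auto
qed

text \<open>The full log is unwound instead of the trimmed stack, so no factor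
  \<open>1 - 2 * \<epsilon>\<close> is lost.\<close>

lemma reduced_total_le_MWM:
  assumes "0 < \<epsilon>" "is_stream S"
  shows "reduced_total \<epsilon> S \<le> MWM S"
proof -
  let ?M = "greedy (map fst (push_log \<epsilon> S))"
  have "reduced_total \<epsilon> S \<le> weight ?M"
    using charged_greedy_weight[OF charged_push_log[OF assms]] assms
    by (simp add: reduced_total_eq)
  also have "\<dots> \<le> MWM S"
    using greedy_subset[of "map fst (push_log \<epsilon> S)"] set_push_log[of \<epsilon> S]
    by (intro weight_le_MWM is_matching_greedy) auto
  finally show ?thesis .
qed

lemma MWM_le_reduced_total:
  assumes "0 < \<epsilon>" "is_stream S"
  shows "MWM S \<le> (2 + 2 * \<epsilon>) * reduced_total \<epsilon> S"
proof (rule MWM_le)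
  fix M assume M: "M \<subseteq> set S" "is_matching M"
  have "weight M \<le> (1 + \<epsilon>) * (\<Sum>x\<in>\<Union>(ends ` M). potential \<epsilon> S x)"
    using matching_weight_le_potential assms M by blast
  also have "\<dots> \<le> (1 + \<epsilon>) * (\<Sum>x\<in>\<Union>(ends ` set S). potential \<epsilon> S x)"
    using assms M potential_nonneg[OF assms] by (intro mult_left_mono sum_mono2) auto
  also have "\<dots> = (1 + \<epsilon>) * (2 * reduced_total \<epsilon> S)"
    by (subst sum_potential) (use assms in auto)
  finally show "weight M \<le> (2 + 2 * \<epsilon>) * reduced_total \<epsilon> S" by (simp add: algebra_simps)
qed

text \<open>Each discarded edge meets \<open>X\<close>, so its reduced weight appears at least once
  in the sum of loads over \<open>X\<close>.\<close>

lemma log_total_filter_disjoint: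
  assumes "finite X" "\<forall>p\<in>set T. 0 \<le> snd p"
  shows "log_total T - (\<Sum>x\<in>X. load T x) \<le> log_total (filter (\<lambda>(e, r). ends e \<inter> X = {}) T)"
  using assms(2)
proof (induction T)
  case (Cons p T)
  obtain e r where p: "p = (e, r)" by (cases p)
  have r: "0 \<le> r" using Cons.prems p by auto
  let ?s = "\<Sum>x\<in>X. if x \<in> ends e then r else 0"
  have "0 \<le> ?s" using r by (intro sum_nonneg) auto
  moreover have "r \<le> ?s" if "x \<in> ends e" "x \<in> X" for x
    using member_le_sum[of x X "\<lambda>x. if x \<in> ends e then r else 0"] that assms(1) r by auto
  moreover have "log_total T - (\<Sum>x\<in>X. load T x) \<le> log_total (filter (\<lambda>(e, r). ends e \<inter> X = {}) T)"
    using Cons by auto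
  ultimately show ?case using p by (auto simp: sum.distrib)
qed simp

text \<open>One matching is weighed twice: unwinding the pushes of \<open>B\<close> that avoid
  \<open>X\<close> bounds it from below, and since it covers only vertices of \<open>V - X\<close>,
  the potentials of \<open>A @ B\<close> bound it from above.\<close>

lemma potential_outside:
  assumes \<epsilon>: "0 < \<epsilon>" and S: "is_stream (A @ B)"
    and V: "finite V" "\<Union>(ends ` set (A @ B)) \<subseteq> V" and X: "X \<subseteq> V"
  shows "reduced_total \<epsilon> B - (\<Sum>x\<in>X. potential \<epsilon> B x)
           \<le> (1 + \<epsilon>) * (\<Sum>x\<in>V - X. potential \<epsilon> (A @ B) x)"
proof -
  have B: "is_stream B" using S by simp
  define T where "T = filter (\<lambda>(e, r). ends e \<inter> X = {}) (push_log \<epsilon> B)"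
  define M where "M = greedy (map fst T)"
  have "charged \<epsilon> (\<lambda>_. 0) T"
    unfolding T_def
    by (rule charged_subseq[OF subseq_filter_left charged_push_log]) (use \<epsilon> B in auto)
  then have 1: "log_total T \<le> weight M" using charged_greedy_weight by (fastforce simp: M_def)
  have MT: "M \<subseteq> fst ` set T" using greedy_subset[of "map fst T"] by (simp add: M_def)
  then have MB: "M \<subseteq> set B" using set_push_log[of \<epsilon> B] by (auto simp: T_def)
  have "ends e \<subseteq> V - X" if "e \<in> M" for e
  proof -
    obtain p where "p \<in> set T" "e = fst p" using MT \<open>e \<in> M\<close> by blast
    then have "ends e \<inter> X = {}" by (simp add: T_def split_beta)
    moreover have "e \<in> set (A @ B)" using MB \<open>e \<in> M\<close> by auto
    then have "ends e \<subseteq> V" using V(2) by blast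
    ultimately show ?thesis by blast
  qed
  then have "\<Union>(ends ` M) \<subseteq> V - X" by (rule UN_least)
  have "log_total (push_log \<epsilon> B) - (\<Sum>x\<in>X. load (push_log \<epsilon> B) x) \<le> log_total T"
    unfolding T_def using V X finite_subset
    by (intro log_total_filter_disjoint) (auto simp: push_log_def)
  then have "reduced_total \<epsilon> B - (\<Sum>x\<in>X. potential \<epsilon> B x) \<le> log_total T"
    using potential_eq_load[OF \<epsilon> B] reduced_total_eq[OF \<epsilon> B] by simp
  also note 1
  also have "weight M \<le> (1 + \<epsilon>) * (\<Sum>x\<in>\<Union>(ends ` M). potential \<epsilon> (A @ B) x)"
    using MB S \<epsilon> by (intro matching_weight_le_potential) (auto simp: M_def is_matching_greedy)
  also have "\<dots> \<le> (1 + \<epsilon>) * (\<Sum>x\<in>V - X. potential \<epsilon> (A @ B) x)"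
    using \<epsilon> V potential_nonneg[OF \<epsilon> S] \<open>\<Union>(ends ` M) \<subseteq> V - X\<close>
    by (intro mult_left_mono sum_mono2) auto
  finally show ?thesis .
qed

lemma MWM_le_lookahead:
  assumes \<epsilon>: "0 < \<epsilon>" and S: "is_stream (A @ B @ C)"
  shows "MWM (A @ B @ C) \<le> 2 * (1 + \<epsilon>) * reduced_total \<epsilon> (A @ B) - reduced_total \<epsilon> B
           + 2 * (1 + \<epsilon>) * reduced_total \<epsilon> (B @ C)"
proof (rule MWM_le)
  fix M assume M: "M \<subseteq> set (A @ B @ C)" "is_matching M"
  have str: "is_stream (A @ B)" "is_stream (B @ C)" using S by auto
  define V where "V = \<Union>(ends ` set (A @ B @ C))"
  \<comment> \<open>Items occurring both in \<open>A\<close> and in \<open>B @ C\<close> go to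
    \<open>N\<close>; thus \<open>L\<close> consists of edges of \<open>A\<close>, covered by the
    potentials of \<open>A @ B\<close>.\<close>
  define N where "N = M \<inter> set (B @ C)"
  define L where "L = M - set (B @ C)"
  define X where "X = \<Union>(ends ` L)"
  define Y where "Y = \<Union>(ends ` N)"
  let ?AB = "potential \<epsilon> (A @ B)" and ?BC = "potential \<epsilon> (B @ C)"
  have finV: "finite V" by (simp add: V_def)
  have sub: "X \<subseteq> V" "Y \<subseteq> V" using M by (auto simp: X_def Y_def V_def L_def N_def)
  have disj: "X \<inter> Y = {}"
  proof (rule ccontr)
    assume "X \<inter> Y \<noteq> {}"
    then obtain x e e' where "e \<in> L" "e' \<in> N" "x \<in> ends e" "x \<in> ends e'"
      unfolding X_def Y_def by blast
    moreover from this have "e \<in> M" "e' \<in> M" "e \<noteq> e'" unfolding L_def N_def by auto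
    ultimately show False using M(2) unfolding is_matching_def by blast
  qed
  have fin: "finite X" "finite Y" using sub finV finite_subset by auto
  have "weight M = weight L + weight N"
    unfolding weight_def L_def N_def
    using M(1) finite_subset by (metis List.finite_set sum.Int_Diff add.commute)
  moreover have "weight L \<le> (1 + \<epsilon>) * (\<Sum>x\<in>X. ?AB x)"
    unfolding X_def using M \<epsilon> str
    by (intro matching_weight_le_potential) (auto simp: L_def is_matching_def)
  moreover have "weight N \<le> (1 + \<epsilon>) * (\<Sum>x\<in>Y. ?BC x)"
    unfolding Y_def using M \<epsilon> str
    by (intro matching_weight_le_potential) (auto simp: N_def is_matching_def)
  moreover have "reduced_total \<epsilon> B - (\<Sum>x\<in>X. potential \<epsilon> B x) \<le> (1 + \<epsilon>) * (\<Sum>x\<in>V - X. ?AB x)"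
    using \<epsilon> str finV sub by (intro potential_outside) (auto simp: V_def)
  \<comment> \<open>The slack factor lets this term join the sum over the disjoint set
    \<open>Y\<close>, so that both together are bounded by the total potential of
    \<open>B @ C\<close>.\<close>
  moreover have "(\<Sum>x\<in>X. potential \<epsilon> B x) \<le> (1 + \<epsilon>) * (\<Sum>x\<in>X. ?BC x)"
  proof -
    have "(\<Sum>x\<in>X. potential \<epsilon> B x) \<le> (\<Sum>x\<in>X. ?BC x)"
      using potential_mono[OF \<epsilon> str(2)] by (intro sum_mono)
    moreover have "0 \<le> \<epsilon> * (\<Sum>x\<in>X. ?BC x)"
      using potential_nonneg[OF \<epsilon> str(2)] \<epsilon> by (intro mult_nonneg_nonneg sum_nonneg) auto
    ultimately show ?thesis by (simp add: algebra_simps)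
  qed
  moreover have "(1 + \<epsilon>) * (\<Sum>x\<in>X. ?AB x) + (1 + \<epsilon>) * (\<Sum>x\<in>V - X. ?AB x)
      = 2 * (1 + \<epsilon>) * reduced_total \<epsilon> (A @ B)"
  proof -
    have "(\<Sum>x\<in>V - X. ?AB x) + (\<Sum>x\<in>X. ?AB x) = (\<Sum>x\<in>V. ?AB x)"
      using sum.subset_diff[OF sub(1) finV, of ?AB] by simp
    also have "\<dots> = 2 * reduced_total \<epsilon> (A @ B)"
      using \<epsilon> str finV by (intro sum_potential) (auto simp: V_def)
    finally have "(1 + \<epsilon>) * ((\<Sum>x\<in>V - X. ?AB x) + (\<Sum>x\<in>X. ?AB x))
        = (1 + \<epsilon>) * (2 * reduced_total \<epsilon> (A @ B))"
      by (rule arg_cong)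
    then show ?thesis by (simp add: algebra_simps)
  qed
  moreover have "(1 + \<epsilon>) * (\<Sum>x\<in>X. ?BC x) + (1 + \<epsilon>) * (\<Sum>x\<in>Y. ?BC x)
      \<le> 2 * (1 + \<epsilon>) * reduced_total \<epsilon> (B @ C)"
  proof -
    have "(\<Sum>x\<in>X. ?BC x) + (\<Sum>x\<in>Y. ?BC x) = (\<Sum>x\<in>X \<union> Y. ?BC x)"
      using sum.union_disjoint[OF fin disj, of ?BC] by simp
    also have "\<dots> \<le> (\<Sum>x\<in>V. ?BC x)"
      using sub finV potential_nonneg[OF \<epsilon> str(2)] by (intro sum_mono2) auto
    also have "\<dots> = 2 * reduced_total \<epsilon> (B @ C)"
      using \<epsilon> str finV by (intro sum_potential) (auto simp: V_def)
    finally have "(1 + \<epsilon>) * ((\<Sum>x\<in>X. ?BC x) + (\<Sum>x\<in>Y. ?BC x))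
        \<le> (1 + \<epsilon>) * (2 * reduced_total \<epsilon> (B @ C))"
      using \<epsilon> by (intro mult_left_mono) auto
    then show ?thesis by (simp add: algebra_simps)
  qed
  ultimately show "weight M \<le> 2 * (1 + \<epsilon>) * reduced_total \<epsilon> (A @ B) - reduced_total \<epsilon> B
      + 2 * (1 + \<epsilon>) * reduced_total \<epsilon> (B @ C)"
    by linarith
qed

text \<open>Here \<open>a\<close>, \<open>b\<close>, \<open>c\<close> stand for the reduced totals
  of \<open>A @ B\<close>, \<open>B\<close>, \<open>B @ C\<close>, and \<open>m\<close> for the
  weight of the output matching on \<open>B @ C\<close>.\<close>

lemma lookahead_arith:
  fixes \<epsilon> \<beta> a b c m :: real
  assumes "0 < \<epsilon>" "\<epsilon> \<le> 1 / 10" "0 < \<beta>" "\<beta> \<le> \<epsilon> / 9"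
    and "(1 - \<beta>) * a \<le> b" "0 \<le> b" "b \<le> c" "(1 - 2 * \<epsilon>) * c \<le> m"
  shows "2 * (1 + \<epsilon>) * a - b + 2 * (1 + \<epsilon>) * c \<le> (3 + 20 * \<epsilon>) * m"
proof -
  have \<beta>: "\<beta> \<le> 1 / 90" using assms by simp
  have "\<beta> * \<beta> \<le> 1 / 90 * \<beta>" using \<beta> assms by (intro mult_right_mono) auto
  \<comment> \<open>Replaces division by \<open>1 - \<beta>\<close>: for small \<beta> its inverse
    is at most \<open>1 + 2 * \<beta>\<close>.\<close>
  then have "1 \<le> (1 - \<beta>) * (1 + 2 * \<beta>)" using assms by (simp add: algebra_simps)
  then have "1 * b \<le> (1 - \<beta>) * (1 + 2 * \<beta>) * b" using assms by (intro mult_right_mono) auto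
  then have "(1 - \<beta>) * a \<le> (1 - \<beta>) * ((1 + 2 * \<beta>) * b)"
    using assms(5) unfolding mult.assoc by linarith
  then have a: "a \<le> (1 + 2 * \<beta>) * b" using \<beta> by (simp add: mult_le_cancel_left)
  have "\<epsilon> * \<beta> \<le> 1 / 10 * \<beta>" using assms by (intro mult_right_mono) auto
  moreover have "2 * (1 + \<epsilon>) * (1 + 2 * \<beta>) = 2 + 2 * \<epsilon> + 4 * \<beta> + 4 * (\<epsilon> * \<beta>)"
    by (simp add: algebra_simps)
  \<comment> \<open>The \<beta> terms add up to at most \<open>4.4 * \<beta>\<close>, which is below
    \<epsilon> because \<open>\<beta> \<le> \<epsilon> / 9\<close>.\<close>
  ultimately have "2 * (1 + \<epsilon>) * (1 + 2 * \<beta>) \<le> 2 + 3 * \<epsilon>"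
    using assms(3,4) by linarith
  then have "2 * (1 + \<epsilon>) * (1 + 2 * \<beta>) * b \<le> (2 + 3 * \<epsilon>) * b"
    using assms by (intro mult_right_mono) auto
  moreover have "2 * (1 + \<epsilon>) * a \<le> 2 * (1 + \<epsilon>) * ((1 + 2 * \<beta>) * b)"
    using a assms by (intro mult_left_mono) auto
  moreover have "(1 + 3 * \<epsilon>) * b \<le> (1 + 3 * \<epsilon>) * c"
    using assms by (intro mult_left_mono) auto
  ultimately have "2 * (1 + \<epsilon>) * a - b + 2 * (1 + \<epsilon>) * c \<le> (3 + 5 * \<epsilon>) * c"
    by (simp add: algebra_simps)
  also have "\<dots> \<le> ((3 + 20 * \<epsilon>) * (1 - 2 * \<epsilon>)) * c"
  proof (rule mult_right_mono)
    \<comment> \<open>The quadratic loss is at most \<open>4 * \<epsilon>\<close>, which leaves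
      \<open>10 * \<epsilon>\<close> where \<open>5 * \<epsilon>\<close> is required.\<close>
    have "\<epsilon> * \<epsilon> \<le> 1 / 10 * \<epsilon>" using assms by (intro mult_right_mono) auto
    moreover have "(3 + 20 * \<epsilon>) * (1 - 2 * \<epsilon>) = 3 + 14 * \<epsilon> - 40 * (\<epsilon> * \<epsilon>)"
      by (simp add: algebra_simps)
    ultimately show "3 + 5 * \<epsilon> \<le> (3 + 20 * \<epsilon>) * (1 - 2 * \<epsilon>)"
      using assms(1) by linarith
  qed (use assms in simp)
  also have "\<dots> \<le> (3 + 20 * \<epsilon>) * m"
    using assms by (simp add: mult.assoc mult_left_mono)
  finally show ?thesis .
qed

theorem theorem8:
  fixes \<epsilon> \<beta> :: real
  assumes "0 < \<epsilon>" and "\<epsilon> \<le> 1 / 10"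
    and "0 < \<beta>" and "\<beta> \<le> \<epsilon> / 9"
  shows "refined_lookahead (is_stream :: 'v wedge list \<Rightarrow> bool) MWM (2 + 2 * \<epsilon>) (3 + 20 * \<epsilon>) \<beta>
           (reduced_total \<epsilon>) (\<lambda>S. weight (ps_matching \<epsilon> S))"
  unfolding refined_lookahead_def
proof (intro allI impI conjI; (elim conjE)?)
  fix S :: "'v wedge list" assume S: "is_stream S"
  show "reduced_total \<epsilon> S \<le> MWM S" using reduced_total_le_MWM assms(1) S .
  show "MWM S \<le> (2 + 2 * \<epsilon>) * reduced_total \<epsilon> S" using MWM_le_reduced_total assms(1) S .
  fix A B C assume ABC: "S = A @ B @ C"
    and look: "(1 - \<beta>) * reduced_total \<epsilon> (A @ B) \<le> reduced_total \<epsilon> B"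
  have BC: "is_stream B" "is_stream (B @ C)" using S ABC by auto
  show "weight (ps_matching \<epsilon> (B @ C)) \<le> MWM (A @ B @ C)"
    using ps_matching_subset[OF assms(1,2) BC(2)]
    by (intro weight_le_MWM is_matching_ps_matching) auto
  have "MWM (A @ B @ C) \<le> 2 * (1 + \<epsilon>) * reduced_total \<epsilon> (A @ B) - reduced_total \<epsilon> B
      + 2 * (1 + \<epsilon>) * reduced_total \<epsilon> (B @ C)"
    using MWM_le_lookahead assms(1) S ABC by blast
  also have "\<dots> \<le> (3 + 20 * \<epsilon>) * weight (ps_matching \<epsilon> (B @ C))"
    using reduced_total_nonneg[OF assms(1) BC(1)] reduced_total_mono[OF assms(1) BC(2)]
      ps_matching_weight[OF assms(1,2) BC(2)] look
    by (intro lookahead_arith[OF assms])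
  finally show "MWM (A @ B @ C) \<le> (3 + 20 * \<epsilon>) * weight (ps_matching \<epsilon> (B @ C))" .
qed

end
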